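(* Let $M>1$ be a real number and let $\alpha:(0,M)\to[0,\infty)$ be a log-concave function. Then the function \[ f(x)=\int_{0}^{M}\alpha(s)\binom{M}{s}(1-x)^{s}x^{M-s}\,ds \] is log-concave in $x$ on the interval $(0,1)$.
   Context: A non-negative function $h$ on an open interval $I$ is called log-concave if for all $x,y\in I$ and all $0<\lambda<1$, $h(\lambda x+(1-\lambda)y)\ge h(x)^{\lambda}h(y)^{1-\lambda}$. For real $a$ and $s$, the generalized binomial coefficient is $\binom{a}{s}=\frac{\Gamma(a+1)}{\Gamma(s+1)\Gamma(a-s+1)}$, where $\Gamma$ is the Gamma function; equivalently, for $0\le s\le M$, $\binom{M}{s}=\frac{1}{(M+1)B(s+1,M-s+1)}$ with $B$ the Beta function. *)

theory Defs
  imports "HOL-Analysis.Analysis"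
begin

text \<open>A non-negative function h on an interval I is log-concave if
  h(l x + (1-l) y) >= h(x)^l h(y)^(1-l) for x, y in I and 0 < l < 1.
  Here powr is used; note 0 powr l = 0 for l > 0, matching real exponentiation.\<close>
definition log_concave_on :: "real set \<Rightarrow> (real \<Rightarrow> real) \<Rightarrow> bool" where
  "log_concave_on I h \<longleftrightarrow>
     (\<forall>x\<in>I. 0 \<le> h x) \<and>
     (\<forall>x\<in>I. \<forall>y\<in>I. \<forall>l::real. 0 < l \<and> l < 1 \<longrightarrow>
        h (l * x + (1 - l) * y) \<ge> h x powr l * h y powr (1 - l))"

definition gbinom :: "real \<Rightarrow> real \<Rightarrow> real" where
  "gbinom a s = Gamma (a + 1) / (Gamma (s + 1) * Gamma (a - s + 1))"

end

theory Submission
  imports Defs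
begin

text \<open>Substituting \<open>u = ln (1 - x) - ln x\<close> turns the transform into \<open>x\<^sup>M\<close> times the Laplace-type
  integral \<open>L(u)\<close> of \<open>\<alpha>(s) binom(M, s) exp(u s)\<close>. With \<open>m = L'/L\<close> and \<open>v = m'\<close>, the mean and the
  variance of the tilted density, the second derivative of \<open>ln f\<close> is nonpositive as soon as
  \<open>v \<le> m (1 - m / M)\<close>, because then it is at most \<open>- (M (1 - x) - m)\<^sup>2 / (M x\<^sup>2 (1 - x)\<^sup>2)\<close>.

  The variance bound says that the product density on \<open>(0, M)\<^sup>2\<close> has nonnegative integral against
  \<open>Q(a, b) = S (2 M - S) - (2 M - 1) (a - b)\<^sup>2\<close>, \<open>S = a + b\<close>, and this holds already on each line of
  constant \<open>S\<close>. By the symmetry \<open>a \<mapsto> M - a\<close> let \<open>S \<le> M\<close>. For \<open>S \<le> 1\<close> the kernel \<open>Q\<close> is nonnegative.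
  Otherwise it changes sign once in \<open>\<bar>a - b\<bar>\<close>, from plus to minus, while \<open>\<alpha>(a) \<alpha>(S - a)\<close> is decreasing
  in \<open>\<bar>a - b\<bar>\<close>, so that it suffices to treat constant \<open>\<alpha>\<close>. In that case the integrand is a difference
  \<open>H(a - 1) - H(a)\<close>, and its integral reduces to integrals of \<open>H\<close> over two unit intervals
  on which \<open>H\<close> has a sign.\<close>

section \<open>Log-concave functions\<close>

lemma log_concave_onI:
  assumes "\<And>x. x \<in> I \<Longrightarrow> 0 \<le> h x"
    and "\<And>x y l. x \<in> I \<Longrightarrow> y \<in> I \<Longrightarrow> 0 < l \<Longrightarrow> l < 1 \<Longrightarrow>
      h x powr l * h y powr (1 - l) \<le> h (l * x + (1 - l) * y)"
  shows "log_concave_on I h"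
  using assms by (simp add: log_concave_on_def)

lemma log_concave_on_nonneg: "log_concave_on I h \<Longrightarrow> x \<in> I \<Longrightarrow> 0 \<le> h x"
  by (simp add: log_concave_on_def)

lemma log_concave_onD:
  assumes "log_concave_on I h" "x \<in> I" "y \<in> I" "0 < l" "l < 1"
  shows "h x powr l * h y powr (1 - l) \<le> h (l * x + (1 - l) * y)"
  using assms by (simp add: log_concave_on_def)

lemma log_concave_on_cong:
  assumes "convex I" "\<And>x. x \<in> I \<Longrightarrow> f x = g x"
  shows "log_concave_on I f \<longleftrightarrow> log_concave_on I g"
proof -
  have "f (l * x + (1 - l) * y) = g (l * x + (1 - l) * y)"
    if "x \<in> I" "y \<in> I" "0 < l" "l < 1" for x y l :: real
    using assms(2) convexD[OF assms(1), of x y l "1 - l"] that by simp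
  then show ?thesis
    using assms(2) by (auto simp: log_concave_on_def)
qed

lemma log_concave_on_const: "0 \<le> c \<Longrightarrow> log_concave_on I (\<lambda>_. c)"
  by (simp add: log_concave_on_def flip: powr_add)

lemma log_concave_on_mult:
  assumes f: "log_concave_on I f" and g: "log_concave_on I g"
  shows "log_concave_on I (\<lambda>x. f x * g x)"
proof (rule log_concave_onI)
  note nonneg = log_concave_on_nonneg[OF f] log_concave_on_nonneg[OF g]
  show "0 \<le> f x * g x" if "x \<in> I" for x
    using nonneg that by simp
  fix x y l :: real
  assume xy: "x \<in> I" "y \<in> I" and l: "0 < l" "l < 1"
  have "(f x * g x) powr l * (f y * g y) powr (1 - l)
      = (f x powr l * f y powr (1 - l)) * (g x powr l * g y powr (1 - l))"
    using nonneg xy by (simp add: powr_mult mult_ac)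
  also have "\<dots> \<le> f (l * x + (1 - l) * y) * g (l * x + (1 - l) * y)"
    using log_concave_onD[OF f xy l] log_concave_onD[OF g xy l]
    by (intro mult_mono) (auto intro: order_trans[rotated])
  finally show "(f x * g x) powr l * (f y * g y) powr (1 - l)
      \<le> f (l * x + (1 - l) * y) * g (l * x + (1 - l) * y)" .
qed

lemma log_concave_on_exp:
  assumes "concave_on I g"
  shows "log_concave_on I (\<lambda>x. exp (g x))"
proof (rule log_concave_onI)
  fix x y l :: real
  assume "x \<in> I" "y \<in> I" "0 < l" "l < 1"
  then show "exp (g x) powr l * exp (g y) powr (1 - l) \<le> exp (g (l * x + (1 - l) * y))"
    using concave_onD[OF assms, of "1 - l" x y] by (simp add: exp_powr_real mult.commute flip: exp_add)
qed simp

lemma log_concave_on_affine: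
  assumes h: "log_concave_on I h" and J: "\<And>x. x \<in> J \<Longrightarrow> c + d * x \<in> I"
  shows "log_concave_on J (\<lambda>x. h (c + d * x))"
proof (rule log_concave_onI)
  show "0 \<le> h (c + d * x)" if "x \<in> J" for x
    using log_concave_on_nonneg[OF h J[OF that]] .
  fix x y l :: real
  assume "x \<in> J" "y \<in> J" "0 < l" "l < 1"
  then have "h (c + d * x) powr l * h (c + d * y) powr (1 - l)
      \<le> h (l * (c + d * x) + (1 - l) * (c + d * y))"
    by (intro log_concave_onD[OF h] J)
  also have "l * (c + d * x) + (1 - l) * (c + d * y) = c + d * (l * x + (1 - l) * y)"
    by (simp add: algebra_simps)
  finally show "h (c + d * x) powr l * h (c + d * y) powr (1 - l)
      \<le> h (c + d * (l * x + (1 - l) * y))" .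
qed

lemma powr_le_imp_le_base:
  fixes x y a :: real
  assumes "x powr a \<le> y powr a" "0 < a" "0 \<le> y"
  shows "x \<le> y"
  using assms powr_less_mono2[of a y x] by linarith

lemma log_concave_on_powr_between_le:
  assumes h: "log_concave_on I h" and I: "x \<in> I" "z \<in> I" and y: "x \<le> y" "y \<le> z"
  shows "h x powr (z - y) * h z powr (y - x) \<le> h y powr (z - x)"
proof (cases "x < y \<and> y < z")
  case True
  define l where "l = (z - y) / (z - x)"
  have l: "0 < l" "l < 1" "l * (z - x) = z - y" "(1 - l) * (z - x) = y - x"
    using True by (auto simp: l_def field_simps)
  have y_eq: "y = l * x + (1 - l) * z"
    using l(3) by (simp add: algebra_simps)
  have nonneg: "0 \<le> h x powr l * h z powr (1 - l)"
    by simp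
  have "h x powr (z - y) * h z powr (y - x) = (h x powr l * h z powr (1 - l)) powr (z - x)"
    unfolding l(3,4)[symmetric] by (simp add: powr_mult powr_powr)
  also have "\<dots> \<le> h y powr (z - x)"
    using True log_concave_onD[OF h I l(1,2)] by (intro powr_mono2) (auto simp flip: y_eq)
  finally show ?thesis .
next
  case False
  then have "y = x \<or> y = z"
    using y by auto
  then show ?thesis
    using y by auto
qed

lemma log_concave_on_min_le:
  assumes h: "log_concave_on I h" and I: "x \<in> I" "z \<in> I" and y: "x \<le> y" "y \<le> z" and "y \<in> I"
  shows "min (h x) (h z) \<le> h y"
proof (cases "x < z")
  case True
  define m where "m = min (h x) (h z)"
  have m: "0 \<le> m" "m \<le> h x" "m \<le> h z"
    using h I by (auto simp: m_def log_concave_on_nonneg)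
  have "m powr (z - x) = m powr (z - y) * m powr (y - x)"
    by (simp flip: powr_add)
  also have "\<dots> \<le> h x powr (z - y) * h z powr (y - x)"
    using m y by (intro mult_mono powr_mono2) auto
  also have "\<dots> \<le> h y powr (z - x)"
    by (rule log_concave_on_powr_between_le[OF h I y])
  finally show ?thesis
    using powr_le_imp_le_base[of m "z - x" "h y"] True log_concave_on_nonneg[OF h \<open>y \<in> I\<close>]
    by (simp flip: m_def)
next
  case False
  then have "x = y" "z = y"
    using y by auto
  then show ?thesis by simp
qed

lemma log_concave_on_mult_le:
  assumes h: "log_concave_on I h" and I: "a \<in> I" "b \<in> I" "c \<in> I" "d \<in> I"
    and sum: "a + b = c + d" and dist: "\<bar>c - d\<bar> \<le> \<bar>a - b\<bar>"
  shows "h a * h b \<le> h c * h d"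
  using I sum dist
proof (induction a b rule: linorder_wlog)
  case (le a b)
  then have between: "a \<le> c" "c \<le> b" "a \<le> d" "d \<le> b"
    by auto
  show ?case
  proof (cases "a = b")
    case True
    then show ?thesis
      using between by auto
  next
    case False
    have nonneg: "0 \<le> h a" "0 \<le> h b" "0 \<le> h c" "0 \<le> h d"
      using le by (auto intro: log_concave_on_nonneg[OF h])
    have exponents: "b - a = (b - c) + (b - d)" "b - a = (c - a) + (d - a)"
      using le by auto
    have "h a powr (b - a) = h a powr (b - c) * h a powr (b - d)"
      by (simp only: exponents(1) powr_add)
    moreover have "h b powr (b - a) = h b powr (c - a) * h b powr (d - a)"
      by (simp only: exponents(2) powr_add)
    ultimately have "(h a * h b) powr (b - a)
        = (h a powr (b - c) * h b powr (c - a)) * (h a powr (b - d) * h b powr (d - a))"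
      using nonneg by (simp add: powr_mult)
    also have "\<dots> \<le> h c powr (b - a) * h d powr (b - a)"
      using le between by (intro mult_mono log_concave_on_powr_between_le[OF h]) auto
    also have "\<dots> = (h c * h d) powr (b - a)"
      using nonneg by (simp add: powr_mult)
    finally show ?thesis
      using powr_le_imp_le_base[of "h a * h b" "b - a" "h c * h d"] False le(1) nonneg by simp
  qed
qed (simp add: mult.commute abs_minus_commute add.commute)

lemma log_concave_on_mult_diff_nonneg:
  assumes h: "log_concave_on I h" and I: "a \<in> I" "b \<in> I" "c \<in> I" "d \<in> I" and sum: "a + b = c + d"
  shows "0 \<le> (h a * h b - h c * h d) * ((c - d)\<^sup>2 - (a - b)\<^sup>2)"
proof (cases "\<bar>a - b\<bar> \<le> \<bar>c - d\<bar>")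
  case True
  then have "h c * h d \<le> h a * h b"
    using I sum by (intro log_concave_on_mult_le[OF h]) auto
  then show ?thesis
    using True by (simp add: abs_le_square_iff)
next
  case False
  then have "h a * h b \<le> h c * h d"
    using I sum by (intro log_concave_on_mult_le[OF h]) auto
  moreover have "(c - d)\<^sup>2 \<le> (a - b)\<^sup>2"
    using False by (simp flip: abs_le_square_iff)
  ultimately show ?thesis
    by (intro mult_nonpos_nonpos) auto
qed

text \<open>The three-point inequality \<open>log_concave_on_powr_between_le\<close> at \<open>x \<le> p < q\<close>,
  solved for \<open>h x\<close>, bounds \<open>h\<close> by a continuous function.\<close>

lemma log_concave_on_bounded_left:
  assumes h: "log_concave_on I h" and "bounded I"
    and I: "p \<in> I" "q \<in> I" and "p < q" and pos: "0 < h p" "0 < h q"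
  shows "bounded (h ` (I \<inter> {..p}))"
proof -
  define \<phi> where "\<phi> x = (h p powr (q - x) / h q powr (p - x)) powr (1 / (q - p))" for x
  obtain c r where r: "I \<subseteq> cball c r"
    using \<open>bounded I\<close> by (auto simp: bounded_subset_cball)
  have "continuous_on (cball c r) \<phi>"
    unfolding \<phi>_def using pos by (intro continuous_intros) auto
  then have "bounded (\<phi> ` cball c r)"
    by (intro compact_imp_bounded compact_continuous_image) auto
  then obtain B where B: "\<forall>x\<in>cball c r. norm (\<phi> x) \<le> B"
    unfolding bounded_iff by blast
  have "h x \<le> \<phi> x" if x: "x \<in> I" "x \<le> p" for x
  proof -
    have "h x powr (q - p) * h q powr (p - x) \<le> h p powr (q - x)"
      using x I \<open>p < q\<close> by (intro log_concave_on_powr_between_le[OF h]) auto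
    also have "\<dots> = \<phi> x powr (q - p) * h q powr (p - x)"
      using pos \<open>p < q\<close> by (simp add: \<phi>_def powr_powr)
    finally have "h x powr (q - p) \<le> \<phi> x powr (q - p)"
      using pos by simp
    then show ?thesis
      by (rule powr_le_imp_le_base) (use \<open>p < q\<close> in \<open>simp_all add: \<phi>_def\<close>)
  qed
  moreover have "\<phi> x \<le> B" if "x \<in> I" for x
    using that r B by fastforce
  ultimately have "norm (h x) \<le> B" if "x \<in> I \<inter> {..p}" for x
    using that log_concave_on_nonneg[OF h, of x] order_trans[of "h x" "\<phi> x" B] by simp
  then show ?thesis
    by (intro boundedI[where B = B]) blast
qed

lemma log_concave_on_bounded_right:
  assumes h: "log_concave_on I h" and "bounded I"
    and I: "p \<in> I" "q \<in> I" and "p < q" and pos: "0 < h p" "0 < h q"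
  shows "bounded (h ` (I \<inter> {q..}))"
proof -
  have "log_concave_on (uminus ` I) (\<lambda>x. h (0 + - 1 * x))"
    by (rule log_concave_on_affine[OF h]) auto
  then have "bounded ((\<lambda>x. h (- x)) ` (uminus ` I \<inter> {..- q}))"
    using assms by (intro log_concave_on_bounded_left[of _ _ "- q" "- p"]) (auto simp: bounded_uminus)
  also have "uminus ` I \<inter> {..- q} = uminus ` (I \<inter> {q..})"
    by auto
  also have "(\<lambda>x. h (- x)) ` uminus ` (I \<inter> {q..}) = h ` (I \<inter> {q..})"
    by (simp add: image_image)
  finally show ?thesis .
qed

lemma log_concave_on_imp_bounded:
  assumes h: "log_concave_on I h" and "is_interval I" "bounded I"
  shows "bounded (h ` I)"
proof (cases "\<exists>p\<in>I. \<exists>q\<in>I. p < q \<and> 0 < h p \<and> 0 < h q")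
  case True
  then obtain p q where pq: "p \<in> I" "q \<in> I" "p < q" "0 < h p" "0 < h q"
    by blast
  define m where "m = (p + q) / 2"
  have m: "p < m" "m < q"
    using pq by (auto simp: m_def)
  then have "m \<in> I"
    using \<open>is_interval I\<close> pq unfolding is_interval_1 by fastforce
  then have "0 < h m"
    using log_concave_on_min_le[OF h, of p q m] pq m by auto
  have "bounded (h ` (I \<inter> {..m}))" "bounded (h ` (I \<inter> {m..}))"
    using pq m \<open>m \<in> I\<close> \<open>0 < h m\<close> \<open>bounded I\<close>
    by (blast intro: log_concave_on_bounded_left[OF h] log_concave_on_bounded_right[OF h])+
  moreover have "I = (I \<inter> {..m}) \<union> (I \<inter> {m..})"
    by auto
  ultimately show ?thesis
    by (metis bounded_Un image_Un)
next
  case False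
  define P where "P = {x \<in> I. 0 < h x}"
  have "p = q" if "p \<in> P" "q \<in> P" for p q
    using False that by (cases p q rule: linorder_cases) (auto simp: P_def)
  then obtain p where "P \<subseteq> {p}"
    by blast
  then have "finite P"
    by (rule finite_subset) simp
  moreover have "h ` I \<subseteq> insert 0 (h ` P)"
    using log_concave_on_nonneg[OF h] by (fastforce simp: P_def)
  ultimately have "finite (h ` I)"
    by (simp add: finite_subset)
  then show ?thesis
    by (rule finite_imp_bounded)
qed

lemma log_concave_on_imp_set_borel_measurable:
  assumes h: "log_concave_on I h" and I: "is_interval I"
  shows "set_borel_measurable borel I h"
  unfolding set_borel_measurable_def borel_measurable_iff_greater
proof
  fix t
  show "{x \<in> space borel. t < indicator I x *\<^sub>R h x} \<in> sets borel"
  proof (cases "t < 0")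
    case True
    then have "{x \<in> space borel. t < indicator I x *\<^sub>R h x} = UNIV"
      using log_concave_on_nonneg[OF h] by (force simp: indicator_def)
    then show ?thesis by simp
  next
    case False
    then have superlevel: "{x \<in> space borel. t < indicator I x *\<^sub>R h x} = {x \<in> I. t < h x}"
      by (auto simp: indicator_def)
    have "is_interval {x \<in> I. t < h x}"
      unfolding is_interval_1
    proof (intro ballI allI impI)
      fix x z y
      assume xz: "x \<in> {x \<in> I. t < h x}" "z \<in> {x \<in> I. t < h x}" and y: "x \<le> y \<and> y \<le> z"
      then have "y \<in> I"
        using I unfolding is_interval_1 by blast
      then show "y \<in> {x \<in> I. t < h x}"
        using log_concave_on_min_le[OF h, of x z y] xz y by auto
    qed
    then show ?thesis
      unfolding superlevel by (rule real_interval_borel_measurable)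
  qed
qed

lemma log_concave_on_imp_set_integrable:
  assumes h: "log_concave_on I h" and I: "is_interval I" "bounded I"
  shows "set_integrable lborel I h"
proof -
  obtain B where B: "\<And>x. x \<in> I \<Longrightarrow> norm (h x) \<le> B"
    using log_concave_on_imp_bounded[OF h I] by (auto simp: bounded_iff)
  show ?thesis
    unfolding set_integrable_def
  proof (rule integrableI_bounded_set[where A = I and B = B])
    show "(\<lambda>x. indicator I x *\<^sub>R h x) \<in> borel_measurable lborel"
      using log_concave_on_imp_set_borel_measurable[OF h I(1)] by (simp add: set_borel_measurable_def)
  qed (use I B emeasure_bounded_finite[OF I(2)] in \<open>auto simp: real_interval_borel_measurable\<close>)
qed

section \<open>Integrals\<close>

lemma integral_diff_shift:
  fixes f :: "real \<Rightarrow> 'a :: banach"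
  assumes f: "f integrable_on {a - d..b}" and "0 \<le> d" "a \<le> b"
  shows "integral {a..b} (\<lambda>x. f (x - d) - f x) = integral {a - d..a} f - integral {b - d..b} f"
proof -
  have subinterval: "f integrable_on {x..y}" if "a - d \<le> x" "y \<le> b" for x y
    using that by (intro integrable_subinterval_real[OF f]) auto
  have "(f \<circ> (+) (- d)) integrable_on {a..b}"
    using subinterval[of "a - d" "b - d"] assms(2,3) has_integral_shift_Icc_real[of f "- d" _ a b]
    by (auto simp: integrable_on_def)
  then have "integral {a..b} (\<lambda>x. (f \<circ> (+) (- d)) x - f x) = integral {a - d..b - d} f - integral {a..b} f"
    using subinterval[of a b] assms(2) integral_shift_Icc_real[of a b f "- d"]
    by (subst integral_diff) auto
  also have "integral {a - d..b - d} f = integral {a - d..b} f - integral {b - d..b} f"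
    using Henstock_Kurzweil_Integration.integral_combine[of "a - d" "b - d" b f] assms
    by (simp add: algebra_simps)
  also have "integral {a..b} f = integral {a - d..b} f - integral {a - d..a} f"
    using Henstock_Kurzweil_Integration.integral_combine[of "a - d" a b f] assms
    by (simp add: algebra_simps)
  finally show ?thesis by simp
qed

lemma integrable_mult_continuous_bounded_support:
  fixes f g :: "'a :: heine_borel \<Rightarrow> real"
  assumes f: "integrable N f" and N: "sets N = sets borel" and supp: "bounded {x. f x \<noteq> 0}"
    and g: "continuous_on UNIV g"
  shows "integrable N (\<lambda>x. g x * f x)"
proof -
  have "compact (g ` closure {x. f x \<noteq> 0})"
    using supp g by (intro compact_continuous_image) (auto intro: continuous_on_subset)
  then have "bounded (g ` closure {x. f x \<noteq> 0})"
    by (rule compact_imp_bounded)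
  then obtain C where C: "\<forall>x\<in>closure {x. f x \<noteq> 0}. norm (g x) \<le> C"
    unfolding bounded_iff by blast
  have bound: "norm (g x * f x) \<le> norm (C * f x)" for x
  proof (cases "f x = 0")
    case False
    then have "norm (g x) \<le> norm C"
      using C closure_subset[of "{x. f x \<noteq> 0}"] by fastforce
    then show ?thesis
      by (simp add: abs_mult mult_right_mono)
  qed simp
  have "g \<in> borel_measurable N"
    using borel_measurable_continuous_onI[OF g] measurable_cong_sets[OF N refl] by blast
  then have "(\<lambda>x. g x * f x) \<in> borel_measurable N"
    using f by (intro borel_measurable_times) auto
  then show ?thesis
    by (rule Bochner_Integration.integrable_bound[of N "\<lambda>x. C * f x", rotated]) (use f bound in auto)
qed

lemma integral_shear:
  fixes f :: "real \<times> real \<Rightarrow> 'a :: {banach, second_countable_topology}"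
  assumes f: "integrable (lborel \<Otimes>\<^sub>M lborel) f"
  shows "(\<integral>a. \<integral>b. f (a, b) \<partial>lborel \<partial>lborel) = (\<integral>s. \<integral>a. f (a, s - a) \<partial>lborel \<partial>lborel)"
proof -
  have translate: "(\<integral>s. f (a, s - a) \<partial>lborel) = (\<integral>b. f (a, b) \<partial>lborel)"
    "(\<integral>s. norm (f (a, s - a)) \<partial>lborel) = (\<integral>b. norm (f (a, b)) \<partial>lborel)" for a
    using lborel_integral_real_affine[of 1 "\<lambda>b. f (a, b)" "- a"]
      lborel_integral_real_affine[of 1 "\<lambda>b. norm (f (a, b))" "- a"] by simp_all
  have [measurable]: "f \<in> borel_measurable (borel \<Otimes>\<^sub>M borel)"
    using f by simp
  have "integrable (lborel \<Otimes>\<^sub>M lborel) (\<lambda>(a, s). f (a, s - a))"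
  proof (rule lborel_pair.Fubini_integrable)
    show "integrable lborel (\<lambda>a. \<integral>s. norm (case (a, s) of (a, s) \<Rightarrow> f (a, s - a)) \<partial>lborel)"
      using lborel_pair.integrable_fst'[OF integrable_norm[OF f]] by (simp add: translate)
    have "integrable lborel (\<lambda>s. f (a, s - a)) \<longleftrightarrow> integrable lborel (\<lambda>b. f (a, b))" for a
      using lborel_integrable_real_affine_iff[of 1 "\<lambda>b. f (a, b)" "- a"] by simp
    then show "AE a in lborel. integrable lborel (\<lambda>s. case (a, s) of (a, s) \<Rightarrow> f (a, s - a))"
      using lborel_pair.AE_integrable_fst'[OF f] by simp
  qed simp
  then show ?thesis
    using lborel_pair.Fubini_integral[of "\<lambda>a s. f (a, s - a)"] by (simp add: translate)
qed

lemma has_real_derivative_integral_quadratic_bound: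
  fixes f :: "real \<Rightarrow> 'a \<Rightarrow> real"
  assumes f: "\<And>t. integrable N (f t)" and f': "integrable N f'" and g: "integrable N g"
    and bound: "\<And>t x. \<bar>t\<bar> \<le> 1 \<Longrightarrow> \<bar>f (u + t) x - f u x - t * f' x\<bar> \<le> t\<^sup>2 * g x"
  shows "((\<lambda>t. \<integral>x. f t x \<partial>N) has_real_derivative (\<integral>x. f' x \<partial>N)) (at u)"
proof -
  define L where "L t = (\<integral>x. f t x \<partial>N)" for t
  define L' where "L' = (\<integral>x. f' x \<partial>N)"
  have "norm ((L (u + t) - L u) / t - L') \<le> \<bar>t\<bar> * (\<integral>x. g x \<partial>N)" if t: "t \<noteq> 0" "\<bar>t\<bar> \<le> 1" for t
  proof -
    have "\<bar>L (u + t) - L u - t * L'\<bar> = \<bar>\<integral>x. f (u + t) x - f u x - t * f' x \<partial>N\<bar>"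
      unfolding L_def L'_def using f f' by simp
    also have "\<dots> \<le> (\<integral>x. \<bar>f (u + t) x - f u x - t * f' x\<bar> \<partial>N)"
      by (rule integral_abs_bound)
    also have "\<dots> \<le> (\<integral>x. t\<^sup>2 * g x \<partial>N)"
      using f f' g bound[OF t(2)] by (intro integral_mono) auto
    also have "\<dots> = \<bar>t\<bar> * (\<bar>t\<bar> * (\<integral>x. g x \<partial>N))"
      by (simp add: power2_eq_square mult.assoc[symmetric])
    finally have "\<bar>L (u + t) - L u - t * L'\<bar> / \<bar>t\<bar> \<le> \<bar>t\<bar> * (\<integral>x. g x \<partial>N)"
      using t(1) by (simp add: divide_le_eq mult.commute)
    moreover have "(L (u + t) - L u) / t - L' = (L (u + t) - L u - t * L') / t"
      using t(1) by (simp add: field_simps)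
    ultimately show ?thesis
      by simp
  qed
  then have "\<forall>\<^sub>F t in at 0. norm ((L (u + t) - L u) / t - L') \<le> \<bar>t\<bar> * (\<integral>x. g x \<partial>N)"
    unfolding eventually_at by (intro exI[of _ 1]) (simp add: dist_real_def)
  moreover have "((\<lambda>t. \<bar>t\<bar> * (\<integral>x. g x \<partial>N)) \<longlongrightarrow> 0) (at 0)"
    by (auto intro!: tendsto_eq_intros)
  ultimately have "((\<lambda>t. (L (u + t) - L u) / t - L') \<longlongrightarrow> 0) (at 0)"
    by (rule Lim_null_comparison)
  then show ?thesis
    unfolding DERIV_def L_def[symmetric] L'_def[symmetric] by (simp flip: Lim_null)
qed

section \<open>The variance kernel\<close>

lemma rGamma_real_nonneg: "0 \<le> x \<Longrightarrow> 0 \<le> rGamma (x :: real)"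
  by (cases "x = 0") (simp_all add: rGamma_inverse_Gamma Gamma_real_pos less_imp_le)

definition binom_weight :: "real \<Rightarrow> real \<Rightarrow> real" where
  "binom_weight M s = rGamma (s + 1) * rGamma (M - s + 1)"

lemma gbinom_eq_binom_weight: "gbinom M s = Gamma (M + 1) * binom_weight M s"
  by (simp add: gbinom_def binom_weight_def rGamma_inverse_Gamma divide_simps)

lemma binom_weight_nonneg: "0 \<le> s \<Longrightarrow> s \<le> M \<Longrightarrow> 0 \<le> binom_weight M s"
  by (simp add: binom_weight_def rGamma_real_nonneg)

lemma binom_weight_reflect: "binom_weight M (M - s) = binom_weight M s"
  by (simp add: binom_weight_def mult.commute)

lemma continuous_on_rGamma_real [continuous_intros]:
  "continuous_on A g \<Longrightarrow> continuous_on A (\<lambda>x. rGamma (g x :: real))"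
  by (rule continuous_on_compose2[OF continuous_on_rGamma[of UNIV]]) auto

lemma continuous_on_binom_weight [continuous_intros]:
  "continuous_on A g \<Longrightarrow> continuous_on A (\<lambda>x. binom_weight M (g x))"
  unfolding binom_weight_def by (intro continuous_intros)

definition var_kernel :: "real \<Rightarrow> real \<Rightarrow> real \<Rightarrow> real" where
  "var_kernel M a b = (a + b) * (2 * M - (a + b)) - (2 * M - 1) * (a - b)\<^sup>2"

lemma var_kernel_reflect: "var_kernel M (M - a) (M - b) = var_kernel M a b"
  by (simp add: var_kernel_def algebra_simps power2_eq_square)

lemma var_kernel_nonneg:
  assumes "0 \<le> a" "0 \<le> b" "a + b \<le> 1" "1 / 2 \<le> M"
  shows "0 \<le> var_kernel M a b"
proof -
  have "(2 * M - 1) * (a - b)\<^sup>2 \<le> (2 * M - 1) * (a + b)\<^sup>2"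
    using assms by (intro mult_left_mono) (auto simp flip: abs_le_square_iff)
  moreover have "0 \<le> 2 * M * ((a + b) * (1 - (a + b)))"
    using assms by simp
  ultimately show ?thesis
    by (simp add: var_kernel_def algebra_simps power2_eq_square)
qed

lemma var_kernel_sign_change:
  assumes S: "1 < S" "S \<le> M"
  obtains c d where "c \<in> {0<..<S}" "d \<in> {0<..<S}" "c + d = S"
    "\<And>a b. a + b = S \<Longrightarrow> var_kernel M a b = (2 * M - 1) * ((c - d)\<^sup>2 - (a - b)\<^sup>2)"
proof
  define D where "D = sqrt (S * (2 * M - S) / (2 * M - 1))"
  have D: "0 \<le> D" "(2 * M - 1) * D\<^sup>2 = S * (2 * M - S)"
    using S by (auto simp: D_def)
  have "S * (2 * M - S) < (2 * M - 1) * S\<^sup>2"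
    using S mult_strict_left_mono[of 1 S "2 * M * S"] by (simp add: algebra_simps power2_eq_square)
  then have "D\<^sup>2 < S\<^sup>2"
    using S by (simp flip: D(2))
  then have "D < S"
    by (rule power2_less_imp_less) (use S in simp)
  then show "(S - D) / 2 \<in> {0<..<S}" "(S + D) / 2 \<in> {0<..<S}" "(S - D) / 2 + (S + D) / 2 = S"
    using D(1) S by (auto simp: field_simps)
  have "(S - D) / 2 - (S + D) / 2 = - D"
    by (simp add: field_simps)
  then show "var_kernel M a b = (2 * M - 1) * (((S - D) / 2 - (S + D) / 2)\<^sup>2 - (a - b)\<^sup>2)"
    if "a + b = S" for a b
    using that D(2) by (simp add: var_kernel_def right_diff_distrib)
qed

definition kernel_potential :: "real \<Rightarrow> real \<Rightarrow> real \<Rightarrow> real" where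
  "kernel_potential M S a =
     (S - 1 - 2 * a) * (rGamma (a + 1) * rGamma (M - a) * (rGamma (S - a) * rGamma (M - S + a + 1)))"

text \<open>Replacing \<^const>\<open>Gamma\<close> by its entire reciprocal makes this identity hold for all real arguments.\<close>

lemma var_kernel_telescopes:
  "binom_weight M a * binom_weight M (S - a) * var_kernel M a (S - a)
     = 2 * (kernel_potential M S (a - 1) - kernel_potential M S a)"
proof -
  define P Q R T where "P = rGamma (a + 1)" "Q = rGamma (M - a + 1)"
    "R = rGamma (S - a + 1)" "T = rGamma (M - S + a + 1)"
  have shifts: "rGamma a = a * P" "rGamma (M - a) = (M - a) * Q"
    "rGamma (S - a) = (S - a) * R" "rGamma (M - S + a) = (M - S + a) * T"
    using rGamma_plus1[of a] rGamma_plus1[of "M - a"] rGamma_plus1[of "S - a"]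
      rGamma_plus1[of "M - S + a"] by (simp_all add: P_Q_R_T_def)
  have args: "M - (a - 1) = M - a + 1" "S - (a - 1) = S - a + 1" "M - (S - a) + 1 = M - S + a + 1"
    "M - S + (a - 1) + 1 = M - S + a" "a - 1 + 1 = a"
    by simp_all
  show ?thesis
    unfolding binom_weight_def kernel_potential_def var_kernel_def args shifts
    unfolding P_Q_R_T_def[symmetric] by (simp add: algebra_simps power2_eq_square)
qed

lemma integral_var_kernel_nonneg:
  assumes S: "1 \<le> S" "S \<le> M"
  shows "0 \<le> integral {0..S} (\<lambda>a. binom_weight M a * binom_weight M (S - a) * var_kernel M a (S - a))"
proof -
  define H where "H = kernel_potential M S"
  have "continuous_on A H" for A
    unfolding H_def kernel_potential_def by (intro continuous_intros)
  then have int: "H integrable_on {x..y}" for x y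
    by (intro integrable_continuous_interval)
  have "integral {0..S} (\<lambda>a. binom_weight M a * binom_weight M (S - a) * var_kernel M a (S - a))
      = 2 * integral {0..S} (\<lambda>a. H (a - 1) - H a)"
    unfolding var_kernel_telescopes H_def[symmetric] by (rule integral_mult_right)
  also have "\<dots> = 2 * (integral {-1..0} H - integral {S - 1..S} H)"
    using integral_diff_shift[of H 0 1 S] int S by simp
  finally have eq: "integral {0..S} (\<lambda>a. binom_weight M a * binom_weight M (S - a) * var_kernel M a (S - a))
      = 2 * (integral {-1..0} H - integral {S - 1..S} H)" .
  have "0 \<le> integral {-1..0} H"
    using int S by (intro integral_nonneg)
      (auto simp: H_def kernel_potential_def intro!: mult_nonneg_nonneg rGamma_real_nonneg)
  moreover have "integral {S - 1..S} H \<le> 0"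
  proof -
    have "H a \<le> 0" if "a \<in> {S - 1..S}" for a
      using S that unfolding H_def kernel_potential_def
      by (intro mult_nonpos_nonneg mult_nonneg_nonneg rGamma_real_nonneg) auto
    then have "integral {S - 1..S} H \<le> integral {S - 1..S} (\<lambda>_. 0)"
      by (rule integral_le[OF int integrable_0])
    then show ?thesis by simp
  qed
  ultimately show ?thesis
    unfolding eq by simp
qed

section \<open>Densities on lines of constant sum\<close>

definition binom_density :: "real \<Rightarrow> (real \<Rightarrow> real) \<Rightarrow> real \<Rightarrow> real" where
  "binom_density M h s = indicator {0<..<M} s * (h s * binom_weight M s)"

lemma binom_density_nonneg:
  assumes "log_concave_on {0<..<M} h"
  shows "0 \<le> binom_density M h s"
  using log_concave_on_nonneg[OF assms] binom_weight_nonneg[of s M]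
  by (auto simp: binom_density_def indicator_def)

lemma binom_density_reflect: "binom_density M h (M - s) = binom_density M (\<lambda>s. h (M - s)) s"
  by (auto simp: binom_density_def binom_weight_reflect indicator_def)

lemma binom_density_bounded_support: "bounded {s. binom_density M h s \<noteq> 0}"
  by (rule bounded_subset[of "{0<..<M}"]) (auto simp: binom_density_def indicator_def split: if_splits)

lemma binom_density_integrable:
  assumes "set_integrable lborel {0<..<M} h"
  shows "integrable lborel (binom_density M h)"
proof -
  have "integrable lborel (\<lambda>s. binom_weight M s * (indicator {0<..<M} s *\<^sub>R h s))"
  proof (rule integrable_mult_continuous_bounded_support[OF _ sets_lborel])
    show "bounded {s. indicator {0<..<M} s *\<^sub>R h s \<noteq> 0}"
      by (rule bounded_subset[of "{0<..<M}"]) (auto simp: indicator_def split: if_splits)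
  qed (use assms in \<open>auto simp: set_integrable_def intro: continuous_on_binom_weight continuous_on_id\<close>)
  then show ?thesis
    by (simp add: binom_density_def[abs_def] mult_ac)
qed

definition kernel_line_integral :: "real \<Rightarrow> (real \<Rightarrow> real) \<Rightarrow> real \<Rightarrow> real" where
  "kernel_line_integral M W S = (\<integral>a. W a * W (S - a) * var_kernel M a (S - a) \<partial>lborel)"

lemma kernel_line_integral_reflect: "kernel_line_integral M W S = kernel_line_integral M (\<lambda>s. W (M - s)) (2 * M - S)"
proof -
  have "kernel_line_integral M W S
      = (\<integral>a. W (M - a) * W (S - (M - a)) * var_kernel M (M - a) (S - (M - a)) \<partial>lborel)"
    unfolding kernel_line_integral_def
    by (subst lborel_integral_real_affine[where c = "-1" and t = M]) simp_all
  also have "(\<lambda>a. S - (M - a)) = (\<lambda>a. M - (2 * M - S - a))"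
    by auto
  finally show ?thesis
    by (simp only: kernel_line_integral_def var_kernel_reflect)
qed

lemma kernel_line_integral_binom_density_const:
  assumes S: "1 \<le> S" "S \<le> M"
  defines "K \<equiv> \<lambda>a. binom_density M (\<lambda>_. 1) a * binom_density M (\<lambda>_. 1) (S - a) * var_kernel M a (S - a)"
  shows "integrable lborel K" "0 \<le> integral\<^sup>L lborel K"
proof -
  define k where "k a = binom_weight M a * binom_weight M (S - a) * var_kernel M a (S - a)" for a
  have K: "K = (\<lambda>a. indicator {0<..<S} a *\<^sub>R k a)"
    using S by (auto simp: K_def k_def binom_density_def indicator_def)
  have "continuous_on {0..S} k"
    unfolding k_def var_kernel_def by (intro continuous_intros)
  then have "set_integrable lborel {0..S} k"
    by (rule borel_integrable_atLeastAtMost')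
  then have int: "set_integrable lborel {0<..<S} k"
    by (rule set_integrable_subset) auto
  then show "integrable lborel K"
    by (simp add: K set_integrable_def)
  have "integral\<^sup>L lborel K = integral {0..S} k"
    using set_borel_integral_eq_integral(2)[OF int]
    by (simp add: K set_lebesgue_integral_def integral_open_interval_real)
  then show "0 \<le> integral\<^sup>L lborel K"
    using integral_var_kernel_nonneg[OF S] by (simp add: k_def[abs_def])
qed

lemma kernel_line_integral_nonneg_of_le_1:
  assumes h: "log_concave_on {0<..<M} h" and "S \<le> 1" "1 / 2 \<le> M"
  shows "0 \<le> kernel_line_integral M (binom_density M h) S"
  unfolding kernel_line_integral_def
proof (rule Bochner_Integration.integral_nonneg)
  fix a
  show "0 \<le> binom_density M h a * binom_density M h (S - a) * var_kernel M a (S - a)"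
  proof (cases "0 < a \<and> a < S")
    case True
    then have "0 \<le> var_kernel M a (S - a)"
      using assms by (intro var_kernel_nonneg) auto
    then show ?thesis
      using binom_density_nonneg[OF h] by simp
  qed (auto simp: binom_density_def)
qed

lemma binom_density_mult_var_kernel_ge:
  assumes h: "log_concave_on {0<..<M} h" and cd: "c \<in> {0<..<M}" "d \<in> {0<..<M}" "a + b = c + d"
    and kernel: "var_kernel M a b = k * ((c - d)\<^sup>2 - (a - b)\<^sup>2)" and "0 \<le> k"
  shows "h c * h d * (binom_density M (\<lambda>_. 1) a * binom_density M (\<lambda>_. 1) b * var_kernel M a b)
    \<le> binom_density M h a * binom_density M h b * var_kernel M a b"
proof (cases "a \<in> {0<..<M} \<and> b \<in> {0<..<M}")
  case True
  then have mem: "a \<in> {0<..<M}" "b \<in> {0<..<M}"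
    by auto
  have "0 \<le> (h a * h b - h c * h d) * ((c - d)\<^sup>2 - (a - b)\<^sup>2)"
    by (intro log_concave_on_mult_diff_nonneg[OF h] mem cd)
  from mult_nonneg_nonneg[OF \<open>0 \<le> k\<close> this]
  have "0 \<le> (h a * h b - h c * h d) * var_kernel M a b"
    by (simp add: kernel mult_ac)
  moreover have "0 \<le> binom_weight M a * binom_weight M b"
    using mem by (intro mult_nonneg_nonneg binom_weight_nonneg) auto
  ultimately have "0 \<le> (binom_weight M a * binom_weight M b) * ((h a * h b - h c * h d) * var_kernel M a b)"
    by (rule mult_nonneg_nonneg[rotated])
  then show ?thesis
    using mem by (simp add: binom_density_def algebra_simps)
qed (auto simp: binom_density_def)

lemma kernel_line_integral_nonneg_of_gt_1:
  assumes h: "log_concave_on {0<..<M} h" and S: "1 < S" "S \<le> M"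
  shows "0 \<le> kernel_line_integral M (binom_density M h) S"
proof -
  obtain c d where cd: "c \<in> {0<..<S}" "d \<in> {0<..<S}" "c + d = S"
    and kernel: "\<And>a b. a + b = S \<Longrightarrow> var_kernel M a b = (2 * M - 1) * ((c - d)\<^sup>2 - (a - b)\<^sup>2)"
    using S by (rule var_kernel_sign_change) blast
  define F where "F g = (\<lambda>a. binom_density M g a * binom_density M g (S - a) * var_kernel M a (S - a))" for g
  note const = kernel_line_integral_binom_density_const[OF less_imp_le[OF S(1)] S(2), folded F_def]
  have le: "h c * h d * F (\<lambda>_. 1) a \<le> F h a" for a
    unfolding F_def using cd S kernel[of a "S - a"]
    by (intro binom_density_mult_var_kernel_ge[OF h, where k = "2 * M - 1"]) auto
  show ?thesis
  proof (cases "integrable lborel (F h)")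
    case True
    have "0 \<le> h c * h d * integral\<^sup>L lborel (F (\<lambda>_. 1))"
      using const(2) cd S by (intro mult_nonneg_nonneg log_concave_on_nonneg[OF h]) auto
    also have "\<dots> = (\<integral>a. h c * h d * F (\<lambda>_. 1) a \<partial>lborel)"
      by simp
    also have "\<dots> \<le> integral\<^sup>L lborel (F h)"
      using const(1) True le by (intro integral_mono) auto
    finally show ?thesis
      by (simp add: kernel_line_integral_def F_def)
  qed (simp add: kernel_line_integral_def F_def not_integrable_integral_eq)
qed

lemma kernel_line_integral_binom_density_nonneg:
  assumes M: "1 < M" and h: "log_concave_on {0<..<M} h"
  shows "0 \<le> kernel_line_integral M (binom_density M h) S"
proof -
  have lower: "0 \<le> kernel_line_integral M (binom_density M g) T"
    if "log_concave_on {0<..<M} g" "T \<le> M" for g T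
    using that M kernel_line_integral_nonneg_of_le_1 kernel_line_integral_nonneg_of_gt_1
    by (cases "T \<le> 1") auto
  show ?thesis
  proof (cases "S \<le> M")
    case True
    then show ?thesis
      by (rule lower[OF h])
  next
    case False
    have "log_concave_on {0<..<M} (\<lambda>s. h (M + - 1 * s))"
      by (rule log_concave_on_affine[OF h]) auto
    then have "0 \<le> kernel_line_integral M (binom_density M (\<lambda>s. h (M - s))) (2 * M - S)"
      using False by (intro lower) auto
    then show ?thesis
      by (simp add: kernel_line_integral_reflect[of M _ S] binom_density_reflect)
  qed
qed

section \<open>Moments of exponentially tilted densities\<close>

definition moment :: "(real \<Rightarrow> real) \<Rightarrow> nat \<Rightarrow> real" where
  "moment W k = (\<integral>s. s ^ k * W s \<partial>lborel)"

definition mean :: "(real \<Rightarrow> real) \<Rightarrow> real" where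
  "mean W = moment W 1 / moment W 0"

definition variance :: "(real \<Rightarrow> real) \<Rightarrow> real" where
  "variance W = moment W 2 / moment W 0 - (mean W)\<^sup>2"

definition tilt :: "real \<Rightarrow> (real \<Rightarrow> real) \<Rightarrow> real \<Rightarrow> real" where
  "tilt u W s = exp (u * s) * W s"

lemma moment_integrable:
  fixes W :: "real \<Rightarrow> real"
  assumes "integrable lborel W" "bounded {s. W s \<noteq> 0}"
  shows "integrable lborel (\<lambda>s. s ^ k * W s)"
  by (intro integrable_mult_continuous_bounded_support[OF assms(1) sets_lborel assms(2)] continuous_intros)

lemma tilt_integrable:
  assumes "integrable lborel W" "bounded {s. W s \<noteq> 0}"
  shows "integrable lborel (tilt u W)"
  unfolding tilt_def[abs_def]
  by (intro integrable_mult_continuous_bounded_support[OF assms(1) sets_lborel assms(2)] continuous_intros)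

lemma tilt_eq_0_iff [simp]: "tilt u W s = 0 \<longleftrightarrow> W s = 0"
  by (simp add: tilt_def)

lemma moment_tilt_pos:
  assumes W: "integrable lborel W" "bounded {s. W s \<noteq> 0}" "\<And>s. 0 \<le> W s"
    and ne: "\<not> (AE s in lborel. W s = 0)"
  shows "0 < moment (tilt u W) 0"
proof -
  have nonneg: "AE s in lborel. 0 \<le> tilt u W s"
    using W(3) by (simp add: tilt_def)
  have "integral\<^sup>L lborel (tilt u W) \<noteq> 0"
    using integral_nonneg_eq_0_iff_AE[OF tilt_integrable[OF W(1,2)] nonneg] ne by simp
  moreover have "0 \<le> integral\<^sup>L lborel (tilt u W)"
    using nonneg by (rule integral_nonneg_AE)
  ultimately show ?thesis
    by (simp add: moment_def)
qed

lemma moment_tilt_has_real_derivative: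
  assumes W: "integrable lborel W" "bounded {s. W s \<noteq> 0}"
  shows "((\<lambda>u. moment (tilt u W) k) has_real_derivative moment (tilt u W) (Suc k)) (at u)"
  unfolding moment_def
proof (rule has_real_derivative_integral_quadratic_bound)
  define g where "g s = (s\<^sup>2 * exp \<bar>s\<bar>) * \<bar>s ^ k * tilt u W s\<bar>" for s
  have int: "integrable lborel (\<lambda>s. s ^ j * tilt v W s)" for j v
    using W by (intro moment_integrable tilt_integrable) auto
  then show "integrable lborel (\<lambda>s. s ^ k * tilt v W s)" for v .
  show "integrable lborel (\<lambda>s. s ^ Suc k * tilt u W s)"
    by (rule int)
  show "integrable lborel g"
    unfolding g_def
  proof (rule integrable_mult_continuous_bounded_support[OF _ sets_lborel])
    show "integrable lborel (\<lambda>s. \<bar>s ^ k * tilt u W s\<bar>)"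
      using int by (rule integrable_abs)
    show "bounded {s. \<bar>s ^ k * tilt u W s\<bar> \<noteq> 0}"
      by (rule bounded_subset[OF W(2)]) auto
    show "continuous_on UNIV (\<lambda>s :: real. s\<^sup>2 * exp \<bar>s\<bar>)"
      by (intro continuous_intros)
  qed
  fix t s :: real
  assume t: "\<bar>t\<bar> \<le> 1"
  have "\<bar>exp (t * s) - 1 - t * s\<bar> \<le> exp \<bar>t * s\<bar> * (t * s)\<^sup>2"
    using Taylor_exp_field[of "t * s" 1] by (simp add: algebra_simps numeral_2_eq_2)
  also have "\<dots> \<le> exp \<bar>s\<bar> * (t * s)\<^sup>2"
    using mult_right_mono[OF t, of "\<bar>s\<bar>"] by (intro mult_right_mono) (auto simp: abs_mult)
  finally have "\<bar>s ^ k * tilt u W s\<bar> * \<bar>exp (t * s) - 1 - t * s\<bar>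
      \<le> \<bar>s ^ k * tilt u W s\<bar> * (exp \<bar>s\<bar> * (t * s)\<^sup>2)"
    by (intro mult_left_mono) auto
  also have "\<bar>s ^ k * tilt u W s\<bar> * \<bar>exp (t * s) - 1 - t * s\<bar>
      = \<bar>s ^ k * tilt (u + t) W s - s ^ k * tilt u W s - t * (s ^ Suc k * tilt u W s)\<bar>"
    unfolding abs_mult[symmetric] by (simp add: tilt_def exp_add algebra_simps)
  finally show "\<bar>s ^ k * tilt (u + t) W s - s ^ k * tilt u W s - t * (s ^ Suc k * tilt u W s)\<bar> \<le> t\<^sup>2 * g s"
    by (simp add: g_def power_mult_distrib mult_ac)
qed

lemma ln_moment_tilt_has_real_derivative:
  assumes W: "integrable lborel W" "bounded {s. W s \<noteq> 0}" and pos: "0 < moment (tilt u W) 0"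
  shows "((\<lambda>u. ln (moment (tilt u W) 0)) has_real_derivative mean (tilt u W)) (at u)"
  using DERIV_chain2[OF DERIV_ln_divide[OF pos] moment_tilt_has_real_derivative[OF W]]
  by (simp add: mean_def)

lemma mean_tilt_has_real_derivative:
  assumes W: "integrable lborel W" "bounded {s. W s \<noteq> 0}" and pos: "0 < moment (tilt u W) 0"
  shows "((\<lambda>u. mean (tilt u W)) has_real_derivative variance (tilt u W)) (at u)"
proof -
  note deriv = moment_tilt_has_real_derivative[OF W]
  have "((\<lambda>u. mean (tilt u W)) has_real_derivative
      (moment (tilt u W) (Suc 1) * moment (tilt u W) 0 - moment (tilt u W) 1 * moment (tilt u W) (Suc 0))
        / (moment (tilt u W) 0 * moment (tilt u W) 0)) (at u)"
    unfolding mean_def using pos by (intro DERIV_divide deriv) auto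
  then show ?thesis
    using pos by (simp add: variance_def mean_def numeral_2_eq_2 field_simps)
qed

lemma log_concave_on_tilt:
  assumes "log_concave_on I h" "convex I"
  shows "log_concave_on I (tilt u h)"
  unfolding tilt_def[abs_def]
proof (intro log_concave_on_mult log_concave_on_exp)
  show "concave_on I (\<lambda>s. u * s)"
    using assms(2) by (simp add: concave_on_iff algebra_simps)
qed (rule assms(1))

lemma tilt_binom_density: "tilt u (binom_density M h) = binom_density M (tilt u h)"
  by (simp add: tilt_def binom_density_def fun_eq_iff)

section \<open>The variance bound\<close>

lemma integral_var_kernel_eq_moments:
  assumes W: "integrable lborel W" "bounded {s. W s \<noteq> 0}"
  shows "(\<integral>a. \<integral>b. W a * W b * var_kernel M a b \<partial>lborel \<partial>lborel)
    = 4 * (M * moment W 1 * moment W 0 + (M - 1) * (moment W 1)\<^sup>2 - M * moment W 2 * moment W 0)"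
proof -
  define m where "m = moment W"
  note int = moment_integrable[OF W]
  have inner: "(\<integral>b. W a * W b * var_kernel M a b \<partial>lborel)
      = (2 * M * m 1 - 2 * M * m 2) * (a ^ 0 * W a) + (2 * M * m 0 + (4 * M - 4) * m 1) * (a ^ 1 * W a)
        - (2 * M * m 0) * (a ^ 2 * W a)" for a
  proof -
    have "(\<integral>b. W a * W b * var_kernel M a b \<partial>lborel)
      = (\<integral>b. W a * (2 * M * a - 2 * M * a\<^sup>2) * (b ^ 0 * W b)
           + W a * (2 * M + (4 * M - 4) * a) * (b ^ 1 * W b) - W a * (2 * M) * (b ^ 2 * W b) \<partial>lborel)"
      by (intro Bochner_Integration.integral_cong refl)
        (simp add: var_kernel_def algebra_simps power2_eq_square)
    also have "\<dots> = W a * (2 * M * a - 2 * M * a\<^sup>2) * m 0 + W a * (2 * M + (4 * M - 4) * a) * m 1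
        - W a * (2 * M) * m 2"
      unfolding m_def moment_def using int[of 0] int[of 1] int[of 2] by simp
    finally show ?thesis
      by (simp add: algebra_simps)
  qed
  have "(\<integral>a. \<integral>b. W a * W b * var_kernel M a b \<partial>lborel \<partial>lborel)
      = (2 * M * m 1 - 2 * M * m 2) * m 0 + (2 * M * m 0 + (4 * M - 4) * m 1) * m 1 - (2 * M * m 0) * m 2"
    unfolding inner unfolding m_def moment_def using int[of 0] int[of 1] int[of 2] by simp
  then show ?thesis
    by (simp add: m_def algebra_simps power2_eq_square)
qed

lemma variance_le_of_kernel_line_integrals:
  assumes M: "0 < M" and W: "integrable lborel W" "bounded {s. W s \<noteq> 0}" "\<And>s. 0 \<le> W s"
    and line: "\<And>S. 0 \<le> kernel_line_integral M W S"
  shows "variance W \<le> mean W - (mean W)\<^sup>2 / M"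
proof -
  have "integrable (lborel \<Otimes>\<^sub>M lborel) (\<lambda>p. W (fst p) * W (snd p))"
    using W(1) by (intro lborel_pair.Fubini_integrable) (auto simp: abs_mult)
  moreover have "bounded {p. W (fst p) * W (snd p) \<noteq> 0}"
    by (rule bounded_subset[OF bounded_Times[OF W(2) W(2)]]) auto
  moreover have "continuous_on UNIV (\<lambda>p. var_kernel M (fst p) (snd p))"
    unfolding var_kernel_def by (intro continuous_intros)
  ultimately have "integrable (lborel \<Otimes>\<^sub>M lborel)
      (\<lambda>p. var_kernel M (fst p) (snd p) * (W (fst p) * W (snd p)))"
    unfolding lborel_prod by (rule integrable_mult_continuous_bounded_support[OF _ sets_lborel])
  from integral_shear[OF this] have "(\<integral>a. \<integral>b. W a * W b * var_kernel M a b \<partial>lborel \<partial>lborel)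
      = (\<integral>S. kernel_line_integral M W S \<partial>lborel)"
    by (simp add: kernel_line_integral_def mult.commute)
  also have "\<dots> \<ge> 0"
    using line by (rule Bochner_Integration.integral_nonneg)
  finally have moments: "M * moment W 2 * moment W 0 \<le> M * moment W 1 * moment W 0 + (M - 1) * (moment W 1)\<^sup>2"
    by (simp add: integral_var_kernel_eq_moments[OF W(1,2)])
  show ?thesis
  proof (cases "moment W 0 = 0")
    case True
    then show ?thesis
      by (simp add: variance_def mean_def)
  next
    case False
    moreover have "0 \<le> moment W 0"
      using W(3) by (simp add: moment_def)
    ultimately have "moment W 2 / moment W 0 \<le> mean W + (1 - 1 / M) * (mean W)\<^sup>2"
      using moments M by (simp add: mean_def field_simps power2_eq_square)
    then show ?thesis
      by (simp add: variance_def algebra_simps)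
  qed
qed

lemma variance_binom_density_le:
  assumes M: "1 < M" and h: "log_concave_on {0<..<M} h"
  shows "variance (binom_density M h) \<le> mean (binom_density M h) - (mean (binom_density M h))\<^sup>2 / M"
proof (rule variance_le_of_kernel_line_integrals)
  have "set_integrable lborel {0<..<M} h"
    using h by (rule log_concave_on_imp_set_integrable) simp_all
  then show "integrable lborel (binom_density M h)"
    by (rule binom_density_integrable)
qed (use M h in \<open>auto intro: binom_density_bounded_support binom_density_nonneg
    kernel_line_integral_binom_density_nonneg\<close>)

section \<open>Log-concavity of the transform\<close>

lemma log_odds_second_derivative_nonpos:
  fixes M x m v :: real
  assumes M: "0 < M" and x: "x \<noteq> 0" "x \<noteq> 1" and v: "v \<le> m - m\<^sup>2 / M"
  shows "- M / x\<^sup>2 + (v + (1 - 2 * x) * m) / (x * (1 - x))\<^sup>2 \<le> 0"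
proof -
  have "- M / x\<^sup>2 = - M * (1 - x)\<^sup>2 / (x * (1 - x))\<^sup>2"
    using x by (simp add: power_mult_distrib)
  then have "- M / x\<^sup>2 + (v + (1 - 2 * x) * m) / (x * (1 - x))\<^sup>2
      = (- M * (1 - x)\<^sup>2 + v + (1 - 2 * x) * m) / (x * (1 - x))\<^sup>2"
    by (simp add: add_divide_distrib diff_divide_distrib)
  also have "\<dots> \<le> (- M * (1 - x)\<^sup>2 + (m - m\<^sup>2 / M) + (1 - 2 * x) * m) / (x * (1 - x))\<^sup>2"
    using v by (intro divide_right_mono) auto
  also have "- M * (1 - x)\<^sup>2 + (m - m\<^sup>2 / M) + (1 - 2 * x) * m = - ((M * (1 - x) - m)\<^sup>2 / M)"
    using M by (simp add: field_simps power2_eq_square)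
  also have "\<dots> / (x * (1 - x))\<^sup>2 \<le> 0"
    using M by simp
  finally show ?thesis .
qed

lemma concave_on_log_odds:
  fixes \<phi> \<phi>' \<phi>'' :: "real \<Rightarrow> real"
  assumes M: "0 < M"
    and deriv: "\<And>u. (\<phi> has_real_derivative \<phi>' u) (at u)" "\<And>u. (\<phi>' has_real_derivative \<phi>'' u) (at u)"
    and le: "\<And>u. \<phi>'' u \<le> \<phi>' u - (\<phi>' u)\<^sup>2 / M"
  shows "concave_on {0<..<1} (\<lambda>x. M * ln x + \<phi> (ln (1 - x) - ln x))"
proof (rule f''_le0_imp_concave)
  define U :: "real \<Rightarrow> real" where "U x = ln (1 - x) - ln x" for x
  fix x :: real
  assume x: "x \<in> {0<..<1}"
  have U: "(U has_real_derivative - 1 / (x * (1 - x))) (at x)"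
    unfolding U_def using x by (auto intro!: derivative_eq_intros simp: field_simps)
  have U': "((\<lambda>x. - 1 / (x * (1 - x))) has_real_derivative (1 - 2 * x) / (x * (1 - x))\<^sup>2) (at x)"
    using x by (auto intro!: derivative_eq_intros simp: power2_eq_square divide_simps)
  have "((\<lambda>x. M * ln x + \<phi> (U x)) has_real_derivative M * (1 / x) + \<phi>' (U x) * (- 1 / (x * (1 - x)))) (at x)"
    using x by (intro DERIV_add DERIV_cmult DERIV_ln_divide DERIV_chain2[OF deriv(1)] U) auto
  then show "((\<lambda>x. M * ln x + \<phi> (ln (1 - x) - ln x)) has_real_derivative
      M / x + \<phi>' (U x) * (- 1 / (x * (1 - x)))) (at x)"
    by (simp add: U_def)
  have "((\<lambda>x. M / x) has_real_derivative - M / x\<^sup>2) (at x)"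
    using x by (auto intro!: derivative_eq_intros simp: power2_eq_square)
  then show "((\<lambda>x. M / x + \<phi>' (U x) * (- 1 / (x * (1 - x)))) has_real_derivative
      - M / x\<^sup>2 + (\<phi>'' (U x) * (- 1 / (x * (1 - x))) * (- 1 / (x * (1 - x)))
        + (1 - 2 * x) / (x * (1 - x))\<^sup>2 * \<phi>' (U x))) (at x)"
    by (intro DERIV_add DERIV_mult DERIV_chain2[OF deriv(2)] U U')
  have "\<phi>'' (U x) * (- 1 / (x * (1 - x))) * (- 1 / (x * (1 - x))) + (1 - 2 * x) / (x * (1 - x))\<^sup>2 * \<phi>' (U x)
      = (\<phi>'' (U x) + (1 - 2 * x) * \<phi>' (U x)) / (x * (1 - x))\<^sup>2"
    by (simp add: power2_eq_square add_divide_distrib)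
  then show "- M / x\<^sup>2 + (\<phi>'' (U x) * (- 1 / (x * (1 - x))) * (- 1 / (x * (1 - x)))
      + (1 - 2 * x) / (x * (1 - x))\<^sup>2 * \<phi>' (U x)) \<le> 0"
    using log_odds_second_derivative_nonpos[OF M _ _ le] x by simp
qed simp

lemma log_concave_on_moment_tilt_log_odds:
  assumes M: "0 < M" and W: "integrable lborel W" "bounded {s. W s \<noteq> 0}" "\<And>s. 0 \<le> W s"
    and variance_le: "\<And>u. variance (tilt u W) \<le> mean (tilt u W) - (mean (tilt u W))\<^sup>2 / M"
  shows "log_concave_on {0<..<1} (\<lambda>x. x powr M * moment (tilt (ln (1 - x) - ln x) W) 0)"
proof (cases "AE s in lborel. W s = 0")
  case True
  then have "moment (tilt u W) 0 = 0" for u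
    unfolding moment_def by (intro integral_eq_zero_AE) simp
  then show ?thesis
    by (simp add: log_concave_on_const)
next
  case False
  then have pos: "0 < moment (tilt u W) 0" for u
    by (rule moment_tilt_pos[OF W])
  have "log_concave_on {0<..<1}
      (\<lambda>x. exp (M * ln x + ln (moment (tilt (ln (1 - x) - ln x) W) 0)))"
    using ln_moment_tilt_has_real_derivative[OF W(1,2) pos]
      mean_tilt_has_real_derivative[OF W(1,2) pos] variance_le
    by (intro log_concave_on_exp concave_on_log_odds[OF M])
  then show ?thesis
    by (rule log_concave_on_cong[THEN iffD1, rotated 2]) (simp_all add: exp_add powr_def pos)
qed

lemma integral_gbinom_eq_moment:
  assumes h: "set_integrable lborel {0<..<M} h" and x: "x \<in> {0<..<1}"
  shows "integral {0..M} (\<lambda>s. h s * gbinom M s * (1 - x) powr s * x powr (M - s))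
    = Gamma (M + 1) * (x powr M * moment (tilt (ln (1 - x) - ln x) (binom_density M h)) 0)"
proof -
  define u where "u = ln (1 - x) - ln x"
  define f where "f s = h s * gbinom M s * (1 - x) powr s * x powr (M - s)" for s
  have f: "indicator {0<..<M} s *\<^sub>R f s = (Gamma (M + 1) * x powr M) * tilt u (binom_density M h) s" for s
  proof -
    have "(1 - x) powr s * x powr (M - s) = x powr M * exp (u * s)"
      using x by (simp add: powr_def u_def algebra_simps flip: exp_add)
    then have "f s = h s * gbinom M s * (x powr M * exp (u * s))"
      by (simp add: f_def mult.assoc)
    then show ?thesis
      by (simp add: tilt_def binom_density_def gbinom_eq_binom_weight)
  qed
  have "integrable lborel (tilt u (binom_density M h))"
    by (intro tilt_integrable binom_density_integrable binom_density_bounded_support h)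
  then have "set_integrable lborel {0<..<M} f"
    unfolding set_integrable_def f by (rule integrable_mult_right)
  then have "integral {0..M} f = (LINT s:{0<..<M}|lborel. f s)"
    by (simp add: set_borel_integral_eq_integral(2) integral_open_interval_real)
  also have "\<dots> = Gamma (M + 1) * (x powr M * moment (tilt u (binom_density M h)) 0)"
    unfolding set_lebesgue_integral_def f by (simp add: moment_def)
  finally show ?thesis
    by (simp add: f_def[abs_def] u_def)
qed

theorem theorem1:
  fixes M :: real and \<alpha> :: "real \<Rightarrow> real"
  assumes "M > 1"
    and "log_concave_on {0<..<M} \<alpha>"
  shows "log_concave_on {0<..<1}
           (\<lambda>x. integral {0..M}
                  (\<lambda>s. \<alpha> s * gbinom M s * (1 - x) powr s * x powr (M - s)))"
proof -
  let ?W = "binom_density M \<alpha>"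
  have \<alpha>_int: "set_integrable lborel {0<..<M} \<alpha>"
    using assms(2) by (rule log_concave_on_imp_set_integrable) simp_all
  have "variance (tilt u ?W) \<le> mean (tilt u ?W) - (mean (tilt u ?W))\<^sup>2 / M" for u
    unfolding tilt_binom_density
    using assms by (intro variance_binom_density_le log_concave_on_tilt) auto
  then have "log_concave_on {0<..<1} (\<lambda>x. x powr M * moment (tilt (ln (1 - x) - ln x) ?W) 0)"
    using assms \<alpha>_int
    by (intro log_concave_on_moment_tilt_log_odds binom_density_integrable
        binom_density_bounded_support binom_density_nonneg) auto
  then have "log_concave_on {0<..<1}
      (\<lambda>x. Gamma (M + 1) * (x powr M * moment (tilt (ln (1 - x) - ln x) ?W) 0))"
    by (rule log_concave_on_mult[OF log_concave_on_const, rotated])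
      (use assms(1) in \<open>simp add: less_imp_le Gamma_real_pos\<close>)
  then show ?thesis
    by (rule log_concave_on_cong[THEN iffD1, rotated 2])
      (simp_all add: integral_gbinom_eq_moment[OF \<alpha>_int])
qed

end
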